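(* An equitable-up-to-one-item ($EQ1$) allocation need not exist under two-sided cardinality constraints. That is, there exist a finite set of re-sellers $U=\{u_1,\dots,u_m\}$, a finite set of products $P=\{p_1,\dots,p_n\}$, nonnegative utilities $(W_{i,j})_{i\in[m],\,j\in[n]}$, and integers $L_1\le L_2$, $R_1\le R_2$, such that at least one feasible allocation exists but no feasible allocation satisfies $EQ1$.
   Context: An instance consists of re-sellers $U=\{u_1,\dots,u_m\}$, products $P=\{p_1,\dots,p_n\}$, utilities $W_{i,j}\ge 0$ (the expected revenue of re-seller $u_i$ from product $p_j$), and nonnegative integers $L_1\le L_2$, $R_1\le R_2$. An allocation is a tuple $A=(A_1,\dots,A_m)$ of subsets $A_i\subseteq P$ (equivalently a binary $m\times n$ matrix); a product may be given to several re-sellers, but each re-seller gets at most one copy of it. The allocation is feasible if it satisfies both the re-seller constraint $L_1\le |A_i|\le L_2$ for every $i\in[m]$, and the product constraint $R_1\le |\{i\in[m] : p_j\in A_i\}|\le R_2$ for every $j\in[n]$. Utilities are additive: $U_i(S)=\sum_{p_j\in S}W_{i,j}$ for $S\subseteq P$. An allocation $A$ satisfies $EQ1$ (equitability up to one item) if for every pair of re-sellers $u_i,u_k$ with $A_k\neq\emptyset$ there exists $p_j\in A_k$ such that $U_i(A_i)\ge U_k(A_k\setminus\{p_j\})$. *)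

theory Defs
  imports Complex_Main
begin

text \<open>
  Re-seller \<open>u\<^sub>i\<close> is represented by the index \<open>i \<in> {1..m}\<close> and product \<open>p\<^sub>j\<close> by \<open>j \<in> {1..n}\<close>.
  An allocation is a function \<open>A\<close> giving the set \<open>A i\<close> of products of each re-seller; its values
  outside \<open>{1..m}\<close> are never inspected.
\<close>

definition allocation :: "nat \<Rightarrow> nat \<Rightarrow> (nat \<Rightarrow> nat set) \<Rightarrow> bool" where
  "allocation m n A \<longleftrightarrow> (\<forall>i\<in>{1..m}. A i \<subseteq> {1..n})"

definition reseller_constraint :: "nat \<Rightarrow> nat \<Rightarrow> nat \<Rightarrow> (nat \<Rightarrow> nat set) \<Rightarrow> bool" where
  "reseller_constraint m L1 L2 A \<longleftrightarrow> (\<forall>i\<in>{1..m}. L1 \<le> card (A i) \<and> card (A i) \<le> L2)"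

definition product_constraint :: "nat \<Rightarrow> nat \<Rightarrow> nat \<Rightarrow> nat \<Rightarrow> (nat \<Rightarrow> nat set) \<Rightarrow> bool" where
  "product_constraint m n R1 R2 A \<longleftrightarrow>
     (\<forall>j\<in>{1..n}. R1 \<le> card {i \<in> {1..m}. j \<in> A i} \<and> card {i \<in> {1..m}. j \<in> A i} \<le> R2)"

definition feasible ::
  "nat \<Rightarrow> nat \<Rightarrow> nat \<Rightarrow> nat \<Rightarrow> nat \<Rightarrow> nat \<Rightarrow> (nat \<Rightarrow> nat set) \<Rightarrow> bool" where
  "feasible m n L1 L2 R1 R2 A \<longleftrightarrow>
     allocation m n A \<and> reseller_constraint m L1 L2 A \<and> product_constraint m n R1 R2 A"

definition utility :: "(nat \<Rightarrow> nat \<Rightarrow> real) \<Rightarrow> nat \<Rightarrow> nat set \<Rightarrow> real" where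
  "utility W i S = (\<Sum>j\<in>S. W i j)"

definition EQ1 :: "nat \<Rightarrow> (nat \<Rightarrow> nat \<Rightarrow> real) \<Rightarrow> (nat \<Rightarrow> nat set) \<Rightarrow> bool" where
  "EQ1 m W A \<longleftrightarrow>
     (\<forall>i\<in>{1..m}. \<forall>k\<in>{1..m}. A k \<noteq> {} \<longrightarrow>
        (\<exists>j\<in>A k. utility W i (A i) \<ge> utility W k (A k - {j})))"

end

theory Submission
  imports Defs
begin

text \<open>
  With two products and \<open>L\<^sub>1 = L\<^sub>2 = 2\<close>, both re-sellers must receive everything. If the first values
  every product at 0 and the second at 1, the second is still strictly better off after losing
  one product.
\<close>

text \<open>The lower bound \<open>L1\<close> is set to \<open>n\<close>, the number of all
  products, so no proper subset is large enough.\<close>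

lemma allocation_eq_all_products:
  assumes "allocation m n A" "reseller_constraint m n L2 A" "i \<in> {1..m}"
  shows "A i = {1..n}"
proof (rule card_seteq)
  show "A i \<subseteq> {1..n}" "card {1..n} \<le> card (A i)"
    using assms by (auto simp: allocation_def reseller_constraint_def)
qed simp

text \<open>Keeps the counterexample from being vacuous. Every product goes to all \<open>m\<close>
  re-sellers, hence the choice \<open>R1 = R2 = m\<close>.\<close>

lemma feasible_all_products: "feasible m n n n m m (\<lambda>_. {1..n})"
proof -
  have "{i \<in> {1..m}. j \<in> {1..n}} = {1..m}" if "j \<in> {1..n}" for j
    using that by auto
  then show ?thesis
    by (simp add: feasible_def allocation_def reseller_constraint_def product_constraint_def)
qed

theorem theorem3p1:
  "\<exists>(m::nat) (n::nat) (W :: nat \<Rightarrow> nat \<Rightarrow> real) (L1::nat) (L2::nat) (R1::nat) (R2::nat).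
     (\<forall>i\<in>{1..m}. \<forall>j\<in>{1..n}. W i j \<ge> 0) \<and> L1 \<le> L2 \<and> R1 \<le> R2 \<and>
     (\<exists>A. feasible m n L1 L2 R1 R2 A) \<and>
     (\<forall>A. feasible m n L1 L2 R1 R2 A \<longrightarrow> \<not> EQ1 m W A)"
proof -
  define W :: "nat \<Rightarrow> nat \<Rightarrow> real" where "W = (\<lambda>i j. if i = 1 then 0 else 1)"
  have "\<not> EQ1 2 W A" if "feasible 2 2 2 2 2 2 A" for A
  proof
    assume EQ1: "EQ1 2 W A"
    have A: "A i = {1..2}" if "i \<in> {1..2}" for i
      using allocation_eq_all_products \<open>feasible 2 2 2 2 2 2 A\<close> that
      unfolding feasible_def by blast
    have "A 1 = {1..2}" "A 2 = {1..2}"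
      by (rule A, simp)+
    \<comment> \<open>The critical pair is \<open>i = 1\<close>, \<open>k = 2\<close>: the re-seller
      with zero values against the other.\<close>
    moreover have "A 2 \<noteq> {} \<longrightarrow> (\<exists>j\<in>A 2. utility W 2 (A 2 - {j}) \<le> utility W 1 (A 1))"
      using EQ1 unfolding EQ1_def by force
    ultimately obtain j where "j \<in> {1..2}" "utility W 2 ({1..2} - {j}) \<le> utility W 1 {1..2}"
      by auto
    \<comment> \<open>\<open>W\<close> ignores the product index, so for either \<open>j\<close> the
      one product left is worth 1 to re-seller 2, while the right-hand side is 0.\<close>
    then show False
      by (simp add: utility_def W_def)
  qed
  moreover have "\<forall>i\<in>{1..2}. \<forall>j\<in>{1..2}. W i j \<ge> 0"
    by (simp add: W_def)
  ultimately show ?thesis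
    using feasible_all_products[of 2 2] by blast
qed

end
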